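(* Let $\Phi$ be a Følner sequence in $\mathbb{Q}$ and let $\varepsilon > 0$. There exists a set $A \subseteq \mathbb{Q}$ such that $\underline{d}_\Phi(A) > 1 - \varepsilon$ and $A - t$ is a set of nonrecurrence for every $t \in \mathbb{Q}$. In particular, $A - t$ does not contain a $\Delta$-set for any $t \in \mathbb{Q}$.
   Context: A Følner sequence in $\mathbb{Q}$ is a sequence $(\Phi_N)$ of finite nonempty subsets with $|(\Phi_N+x)\triangle\Phi_N|/|\Phi_N|\to0$ for all $x$. $\underline{d}_\Phi(A)=\liminf_N|A\cap\Phi_N|/|\Phi_N|$. A $\mathbb{Q}$-system $(X,\mu,T)$: $X$ compact metric, $T$ an action of $(\mathbb{Q},+)$ by homeomorphisms, $\mu$ a $T$-invariant Borel probability measure. $R\subseteq\mathbb{Q}$ is a set of recurrence if for every $\mathbb{Q}$-system $(X,\mu,T)$ and every measurable $E$ with $\mu(E)>0$ there exists $r\in R$ with $\mu(E\cap T^{-r}E)>0$; otherwise it is a set of nonrecurrence. A $\Delta$-set is a set of the form $\{b_j-b_i:i<j\}$ for an infinite set $B=\{b_n:n\in\mathbb{N}\}\subseteq\mathbb{Q}$.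
   Formalization: In the definition of a set of recurrence the return time r is required to be nonzero; with r = 0 allowed, every set containing 0 is a set of recurrence, so A − t would be recurrent for each t in A and the claim would fail for ε ≤ 1. *)

theory Defs
  imports "HOL-Probability.Probability"
begin

definition Folner_seq :: "(nat \<Rightarrow> rat set) \<Rightarrow> bool" where
  "Folner_seq \<Phi> \<longleftrightarrow>
     (\<forall>N. finite (\<Phi> N) \<and> \<Phi> N \<noteq> {}) \<and>
     (\<forall>x. (\<lambda>N. real (card (sym_diff ((\<lambda>a. a + x) ` \<Phi> N) (\<Phi> N))) / real (card (\<Phi> N)))
            \<longlonglongrightarrow> 0)"

definition lower_density :: "(nat \<Rightarrow> rat set) \<Rightarrow> rat set \<Rightarrow> ereal" where
  "lower_density \<Phi> A = liminf (\<lambda>N. ereal (real (card (A \<inter> \<Phi> N)) / real (card (\<Phi> N))))"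

definition rat_shift :: "rat set \<Rightarrow> rat \<Rightarrow> rat set" where
  "rat_shift A t = (\<lambda>a. a - t) ` A"

definition Q_action :: "'a topology \<Rightarrow> (rat \<Rightarrow> 'a \<Rightarrow> 'a) \<Rightarrow> bool" where
  "Q_action X T \<longleftrightarrow>
     (\<forall>q. homeomorphic_map X X (T q)) \<and>
     (\<forall>x \<in> topspace X. T 0 x = x) \<and>
     (\<forall>p q. \<forall>x \<in> topspace X. T (p + q) x = T p (T q x))"

definition Q_system ::
  "'a set \<Rightarrow> ('a \<Rightarrow> 'a \<Rightarrow> real) \<Rightarrow> 'a measure \<Rightarrow> (rat \<Rightarrow> 'a \<Rightarrow> 'a) \<Rightarrow> bool" where
  "Q_system X d \<mu> T \<longleftrightarrow>
     Metric_space X d \<and>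
     compact_space (Metric_space.mtopology X d) \<and>
     Q_action (Metric_space.mtopology X d) T \<and>
     space \<mu> = X \<and>
     sets \<mu> = sigma_sets X {U. openin (Metric_space.mtopology X d) U} \<and>
     prob_space \<mu> \<and>
     (\<forall>q. \<forall>E \<in> sets \<mu>. measure \<mu> (T q -` E \<inter> X) = measure \<mu> E)"

text \<open>
  HOL cannot quantify over all types inside a definition, so systems are taken on carriers
  \<open>X :: real set\<close> with an arbitrary metric \<open>d\<close>, unrelated to the usual distance on the reals.
  There is no loss of generality: a compact metric space has at most the cardinality of the
  continuum, so every system is isomorphic (isometrically) to one on such a carrier.

  The return time \<open>r\<close> is required to be nonzero. Since the set \<open>E \<inter> T\<^sup>0 E = E\<close> has positive
  measure, allowing \<open>r = 0\<close> would make every set containing 0 a set of recurrence,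
  and then no nonempty set could have all of its translates nonrecurrent.
\<close>

definition set_of_recurrence :: "rat set \<Rightarrow> bool" where
  "set_of_recurrence R \<longleftrightarrow>
     (\<forall>(X :: real set) d \<mu> T. Q_system X d \<mu> T \<longrightarrow>
        (\<forall>E \<in> sets \<mu>. measure \<mu> E > 0 \<longrightarrow>
           (\<exists>r \<in> R. r \<noteq> 0 \<and> measure \<mu> (E \<inter> (T r -` E \<inter> X)) > 0)))"

definition set_of_nonrecurrence :: "rat set \<Rightarrow> bool" where
  "set_of_nonrecurrence R \<longleftrightarrow> \<not> set_of_recurrence R"

definition Delta_set :: "rat set \<Rightarrow> bool" where
  "Delta_set D \<longleftrightarrow>
     (\<exists>b :: nat \<Rightarrow> rat. infinite (range b) \<and> D = {b j - b i | i j. i < j})"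

end

theory Submission
  imports Defs
begin

text \<open>
  Fix an irrational \<open>\<alpha>\<close> and let \<open>\<rat>\<close> act on the circle by the rotations \<open>x \<mapsto> x + q\<alpha>\<close>.
  Writing \<open>\<parallel>x\<parallel>\<close> for the distance to the nearest integer, a set \<open>R\<close> is nonrecurrent, and contains
  no \<open>\<Delta>\<close>-set, as soon as \<open>\<parallel>r\<alpha>\<parallel>\<close> is bounded away from 0 on \<open>R - {0}\<close>. The sets
  \<open>{r. \<parallel>r\<alpha>\<parallel> < \<delta>}\<close> have arbitrarily many disjoint translates when \<open>\<delta>\<close> is small, hence arbitrarily
  small upper density. For each \<open>t\<close> remove from \<open>\<rat>\<close> the points \<open>q\<close> with \<open>\<parallel>(q - t)\<alpha>\<parallel> < \<delta>\<^sub>t\<close>, except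
  for a finite set \<open>F\<^sub>t\<close> that covers the Folner sets on which the density bound does not yet hold; so
  the removed proportions are summable on every Folner set. The finite sets \<open>F\<^sub>t\<close> do no harm
  because \<open>q \<mapsto> q\<alpha>\<close> is injective modulo 1.
\<close>

section \<open>The circle as a compact metric space\<close>

definition circle_norm :: "real \<Rightarrow> real" where
  "circle_norm x = \<bar>x - of_int (round x)\<bar>"

definition circle_dist :: "real \<Rightarrow> real \<Rightarrow> real" where
  "circle_dist x y = circle_norm (x - y)"

text \<open>Upper bounds on \<open>circle_norm\<close> come from exhibiting any integer; the nearest
  one never has to be identified.\<close>

lemma circle_norm_le: "circle_norm x \<le> \<bar>x - of_int m\<bar>"
  unfolding circle_norm_def by (rule round_diff_minimal)

lemma circle_norm_le_abs: "circle_norm x \<le> \<bar>x\<bar>"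
  using circle_norm_le[of x 0] by simp

lemma circle_norm_nonneg [simp]: "0 \<le> circle_norm x"
  by (simp add: circle_norm_def)

lemma circle_norm_eq_0_iff: "circle_norm x = 0 \<longleftrightarrow> x \<in> \<int>"
  by (auto simp: circle_norm_def elim!: Ints_cases) (metis Ints_of_int)

lemma circle_norm_minus [simp]: "circle_norm (- x) = circle_norm x"
proof -
  have "circle_norm (- y) \<le> circle_norm y" for y
    using circle_norm_le[of "- y" "- round y"] by (simp add: circle_norm_def abs_minus_commute)
  from this[of x] this[of "- x"] show ?thesis by simp
qed

lemma circle_norm_triangle: "circle_norm (x + y) \<le> circle_norm x + circle_norm y"
  using circle_norm_le[of "x + y" "round x + round y"] by (simp add: circle_norm_def)

lemma circle_norm_add_of_int [simp]: "circle_norm (x + of_int n) = circle_norm x"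
proof -
  have "circle_norm (y + of_int m) \<le> circle_norm y" for y m
    using circle_norm_le[of "y + of_int m" "round y + m"] by (simp add: circle_norm_def)
  from this[of x n] this[of "x + of_int n" "- n"] show ?thesis by simp
qed

lemma circle_dist_commute: "circle_dist x y = circle_dist y x"
  using circle_norm_minus[of "x - y"] by (simp add: circle_dist_def)

lemma circle_dist_le_abs: "circle_dist x y \<le> \<bar>x - y\<bar>"
  by (simp add: circle_dist_def circle_norm_le_abs)

lemma circle_dist_triangle: "circle_dist x z \<le> circle_dist x y + circle_dist y z"
  using circle_norm_triangle[of "x - y" "y - z"] by (simp add: circle_dist_def)

lemma circle_dist_frac_left [simp]: "circle_dist (frac x) y = circle_dist x y"
  using circle_norm_add_of_int[of "x - y" "- \<lfloor>x\<rfloor>"]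
  by (simp add: circle_dist_def frac_def algebra_simps)

lemma circle_dist_frac_right [simp]: "circle_dist x (frac y) = circle_dist x y"
  by (metis circle_dist_commute circle_dist_frac_left)

lemma circle_dist_add [simp]: "circle_dist (x + a) (y + a) = circle_dist x y"
  by (simp add: circle_dist_def)

text \<open>The carrier holds exactly one representative of each class modulo 1, so distance 0, that
  is, an integral difference, forces equality.\<close>

global_interpretation circle: Metric_space "{0..<1::real}" circle_dist
proof
  show "0 \<le> circle_dist x y" for x y by (simp add: circle_dist_def)
  show "circle_dist x y = circle_dist y x" for x y by (rule circle_dist_commute)
  show "circle_dist x z \<le> circle_dist x y + circle_dist y z" for x y z
    by (rule circle_dist_triangle)
  show "circle_dist x y = 0 \<longleftrightarrow> x = y" if "x \<in> {0..<1}" "y \<in> {0..<1}" for x y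
  proof
    assume "circle_dist x y = 0"
    then obtain n where n: "x - y = of_int n"
      by (auto simp: circle_dist_def circle_norm_eq_0_iff elim!: Ints_cases)
    then have "- 1 < real_of_int n" "real_of_int n < 1" using that by auto
    then have "n = 0" by linarith
    then show "x = y" using n by simp
  qed (simp add: circle_dist_def circle_norm_eq_0_iff)
qed

text \<open>\<open>frac\<close> is 1-Lipschitz from the usual distance to
  \<open>circle_dist\<close>, even across the jumps at the integers.\<close>

lemma continuous_map_frac_circle: "continuous_map euclidean circle.mtopology frac"
  unfolding circle.continuous_map_to_metric
proof (intro ballI allI impI)
  fix x e :: real
  assume "e > 0"
  then show "\<exists>U. openin euclidean U \<and> x \<in> U \<and> (\<forall>y\<in>U. frac y \<in> circle.mball (frac x) e)"
    by (intro exI[of _ "ball x e"])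
      (auto simp: circle.in_mball frac_lt_1 dist_real_def
        intro: le_less_trans[OF circle_dist_le_abs])
qed

lemma frac_image_unit_interval: "frac ` {0..1::real} = {0..<1}"
proof -
  have "x \<in> frac ` {0..1}" if "x \<in> {0..<1}" for x :: real
    using that by (intro image_eqI[of _ _ x]) (auto simp: frac_eq)
  then show ?thesis by (auto simp: frac_lt_1)
qed

text \<open>The half-open carrier is not compact in the usual topology; here it is the continuous
  image of \<open>{0..1}\<close> under \<open>frac\<close>.\<close>

lemma compact_space_circle: "compact_space circle.mtopology"
proof -
  have "compactin circle.mtopology (frac ` {0..1})"
    by (rule image_compactin[OF _ continuous_map_frac_circle]) simp
  then show ?thesis by (simp add: compact_space_def frac_image_unit_interval)
qed

section \<open>The rotation action of the rationals\<close>

definition circle_rotation :: "real \<Rightarrow> rat \<Rightarrow> real \<Rightarrow> real" where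
  "circle_rotation \<alpha> q x = frac (x + of_rat q * \<alpha>)"

text \<open>Rotations are isometries, since \<open>circle_dist\<close> ignores \<open>frac\<close>
  and common translations.\<close>

lemma continuous_map_circle_rotation:
  "continuous_map circle.mtopology circle.mtopology (circle_rotation \<alpha> q)"
  unfolding circle.metric_continuous_map[OF circle.Metric_space_axioms]
  by (auto simp: circle_rotation_def frac_lt_1)

lemma circle_rotation_add:
  "circle_rotation \<alpha> (p + q) x = circle_rotation \<alpha> p (circle_rotation \<alpha> q x)"
  by (simp add: circle_rotation_def of_rat_add algebra_simps)

lemma circle_rotation_0: "x \<in> {0..<1} \<Longrightarrow> circle_rotation \<alpha> 0 x = x"
  by (simp add: circle_rotation_def frac_eq)

lemma Q_action_circle_rotation: "Q_action circle.mtopology (circle_rotation \<alpha>)"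
  unfolding Q_action_def
proof (intro conjI allI ballI)
  fix q
  have "homeomorphic_maps circle.mtopology circle.mtopology
          (circle_rotation \<alpha> q) (circle_rotation \<alpha> (- q))"
    by (auto simp: homeomorphic_maps_def continuous_map_circle_rotation
        circle_rotation_add[symmetric] circle_rotation_0)
  then show "homeomorphic_map circle.mtopology circle.mtopology (circle_rotation \<alpha> q)"
    by (simp add: homeomorphic_maps_map)
qed (auto simp: circle_rotation_add circle_rotation_0)

section \<open>Lebesgue measure on the circle and its invariance\<close>

text \<open>As \<open>frac\<close> fixes the carrier, this is Lebesgue measure. Pushing forward
  along \<open>frac\<close> places it on the sigma-algebra of the circle topology, with no
  comparison to the Borel sets of the reals.\<close>

definition circle_measure :: "real measure" where
  "circle_measure = distr (uniform_measure lborel {0..<1})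
     (sigma {0..<1} {U. openin circle.mtopology U}) frac"

lemma openin_circle_subset: "{U. openin circle.mtopology U} \<subseteq> Pow {0..<1}"
  using openin_subset[of circle.mtopology] by auto

lemma space_circle_measure: "space circle_measure = {0..<1}"
  by (simp add: circle_measure_def space_measure_of[OF openin_circle_subset])

lemma sets_circle_measure:
  "sets circle_measure = sigma_sets {0..<1} {U. openin circle.mtopology U}"
  by (simp add: circle_measure_def sets_measure_of[OF openin_circle_subset])

lemma measurable_frac_circle:
  "frac \<in> borel \<rightarrow>\<^sub>M sigma {0..<1} {U. openin circle.mtopology U}"
proof (rule measurable_measure_of[OF openin_circle_subset])
  show "frac \<in> space borel \<rightarrow> {0..<1::real}" by (auto simp: frac_lt_1)
  fix U assume "U \<in> {U. openin circle.mtopology U}"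
  then have "open (frac -` U)"
    using openin_continuous_map_preimage[OF continuous_map_frac_circle] by (auto simp: vimage_def)
  then show "frac -` U \<inter> space borel \<in> sets borel" by simp
qed

lemma circle_measurable_vimage: 
  assumes "E \<in> sets circle_measure" shows "frac -` E \<in> sets borel"
  using measurable_sets[OF measurable_frac_circle, of E] assms
  by (simp add: sets_circle_measure sets_measure_of[OF openin_circle_subset])

lemma measure_circle:
  assumes "E \<in> sets circle_measure"
  shows "measure circle_measure E = measure lborel ({0..<1} \<inter> frac -` E)"
proof -
  have "measure circle_measure E = measure (uniform_measure lborel {0..<1}) (frac -` E)"
    unfolding circle_measure_def
    using assms measurable_frac_circle
    by (subst measure_distr)
      (auto simp: sets_circle_measure sets_measure_of[OF openin_circle_subset] measurable_def)
  also have "\<dots> = measure lborel ({0..<1} \<inter> frac -` E)"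
    using circle_measurable_vimage[OF assms]
    by (subst measure_uniform_measure) auto
  finally show ?thesis .
qed

lemma prob_space_circle: "prob_space circle_measure"
  unfolding circle_measure_def
proof (rule prob_space.prob_space_distr)
  show "prob_space (uniform_measure lborel {0..<1::real})"
    by (rule prob_space_uniform_measure) auto
  show "frac \<in> uniform_measure lborel {0..<1} \<rightarrow>\<^sub>M sigma {0..<1} {U. openin circle.mtopology U}"
    using measurable_frac_circle by (simp add: measurable_def)
qed

lemma measure_lborel_translate:
  fixes S :: "real set"
  assumes "S \<in> sets borel"
  shows "measure lborel ((\<lambda>x. c + x) -` S) = measure lborel S"
proof -
  have "measure lborel S = measure (distr lborel borel ((+) c)) S"
    by (simp add: lborel_distr_plus)
  also have "\<dots> = measure lborel ((\<lambda>x. c + x) -` S)"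
    using assms by (subst measure_distr) auto
  finally show ?thesis by simp
qed

text \<open>With \<open>b = frac a\<close>, cut the interval at \<open>1 - b\<close>: the left piece
  is translated to \<open>{b..<1}\<close>, the right piece wraps around to
  \<open>{0..<b}\<close>.\<close>

lemma measure_unit_interval_frac_shift:
  fixes a :: real
  assumes "frac -` E \<in> sets borel"
  shows "measure lborel ({0..<1} \<inter> {x. frac (x + a) \<in> E}) = measure lborel ({0..<1} \<inter> frac -` E)"
proof -
  define b where "b = frac a"
  have b: "0 \<le> b" "b < 1" by (auto simp: b_def frac_lt_1)
  let ?B = "frac -` E"
  let ?m = "measure (lborel :: real measure)"
  \<comment> \<open>Additivity of the real-valued \<open>measure\<close> needs pieces of finite
    measure.\<close>
  have fin: "emeasure lborel ({c..<d} \<inter> S) \<noteq> \<infinity>" if "S \<in> sets borel" for c d :: real and S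
  proof -
    have "emeasure lborel ({c..<d} \<inter> S) \<le> emeasure lborel {c..<d}"
      using that by (intro emeasure_mono) auto
    also have "\<dots> < \<infinity>" by (cases "c \<le> d") auto
    finally show ?thesis by simp
  qed
  have shift: "(\<lambda>x. c + x) -` ?B \<in> sets borel" for c
    using measurable_sets[of "\<lambda>x. c + x" borel borel ?B] assms by simp
  have "{0..<1} \<inter> {x. frac (x + a) \<in> E} = {0..<1} \<inter> (\<lambda>x. b + x) -` ?B"
    by (auto simp: b_def add.commute)
  also have "\<dots> = ({0..<1 - b} \<inter> (\<lambda>x. b + x) -` ?B) \<union> ({1 - b..<1} \<inter> (\<lambda>x. b + x) -` ?B)"
    using b by auto
  also have "?m \<dots> = ?m ({0..<1 - b} \<inter> (\<lambda>x. b + x) -` ?B) + ?m ({1 - b..<1} \<inter> (\<lambda>x. b + x) -` ?B)"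
    by (intro measure_Union fin shift) (use shift in auto)
  also have "{0..<1 - b} \<inter> (\<lambda>x. b + x) -` ?B = (\<lambda>x. b + x) -` ({b..<1} \<inter> ?B)"
    by auto
  also have "?m \<dots> = ?m ({b..<1} \<inter> ?B)"
    using assms by (intro measure_lborel_translate) auto
  \<comment> \<open>Translating by \<open>b - 1\<close> instead of \<open>b\<close> leaves
    \<open>frac\<close> unchanged and lands in \<open>{0..<b}\<close>.\<close>
  also have "{1 - b..<1} \<inter> (\<lambda>x. b + x) -` ?B = (\<lambda>x. (b - 1) + x) -` ({0..<b} \<inter> ?B)"
  proof -
    have "frac (b + x) = frac (b - 1 + x)" for x
      using frac_add_of_int_right[of "b - 1 + x" 1] by (simp add: algebra_simps)
    then show ?thesis by auto
  qed
  also have "?m \<dots> = ?m ({0..<b} \<inter> ?B)"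
    using assms by (intro measure_lborel_translate) auto
  also have "?m ({b..<1} \<inter> ?B) + ?m ({0..<b} \<inter> ?B) = ?m (({b..<1} \<inter> ?B) \<union> ({0..<b} \<inter> ?B))"
    by (intro measure_Union[symmetric] fin assms) (use assms in auto)
  also have "({b..<1} \<inter> ?B) \<union> ({0..<b} \<inter> ?B) = {0..<1} \<inter> ?B"
    using b by auto
  finally show ?thesis .
qed

lemma circle_rotation_invariant:
  assumes "E \<in> sets circle_measure"
  shows "measure circle_measure (circle_rotation \<alpha> q -` E \<inter> {0..<1}) = measure circle_measure E"
proof -
  \<comment> \<open>Measurability follows from continuity on the generating open sets; it makes
    \<open>measure_circle\<close> applicable to the preimage of \<open>E\<close>.\<close>
  have cont: "circle_rotation \<alpha> q \<in> circle_measure \<rightarrow>\<^sub>M circle_measure"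
  proof (rule measurable_sigma_sets[OF sets_circle_measure openin_circle_subset])
    show "circle_rotation \<alpha> q \<in> space circle_measure \<rightarrow> {0..<1}"
      by (auto simp: circle_rotation_def frac_lt_1)
    fix U assume "U \<in> {U. openin circle.mtopology U}"
    then have "openin circle.mtopology {x \<in> {0..<1}. circle_rotation \<alpha> q x \<in> U}"
      using openin_continuous_map_preimage[OF continuous_map_circle_rotation] by auto
    moreover have "{x \<in> {0..<1}. circle_rotation \<alpha> q x \<in> U} =
        circle_rotation \<alpha> q -` U \<inter> space circle_measure"
      by (auto simp: space_circle_measure)
    ultimately show "circle_rotation \<alpha> q -` U \<inter> space circle_measure \<in> sets circle_measure"
      by (auto simp: sets_circle_measure)
  qed
  have "measure circle_measure (circle_rotation \<alpha> q -` E \<inter> {0..<1})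
      = measure lborel ({0..<1} \<inter> frac -` (circle_rotation \<alpha> q -` E \<inter> {0..<1}))"
    using measurable_sets[OF cont assms] by (intro measure_circle) (simp add: space_circle_measure)
  also have "frac -` (circle_rotation \<alpha> q -` E \<inter> {0..<1}) = {x. frac (x + of_rat q * \<alpha>) \<in> E}"
    by (auto simp: circle_rotation_def frac_lt_1)
  also have "measure lborel ({0..<1} \<inter> \<dots>) = measure lborel ({0..<1} \<inter> frac -` E)"
    by (rule measure_unit_interval_frac_shift[OF circle_measurable_vimage[OF assms]])
  also have "\<dots> = measure circle_measure E"
    using assms by (simp add: measure_circle)
  finally show ?thesis .
qed

lemma Q_system_circle_rotation:
  "Q_system {0..<1} circle_dist circle_measure (circle_rotation \<alpha>)"
  unfolding Q_system_def
  using circle.Metric_space_axioms compact_space_circle Q_action_circle_rotation prob_space_circle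
    circle_rotation_invariant space_circle_measure sets_circle_measure
  by blast

section \<open>Consequences of a gap at 0: nonrecurrence and absence of \<Delta>-sets\<close>

text \<open>The ball of radius \<open>\<delta> / 2\<close> about 0 is the witness: a point returning
  to it under \<open>r\<close> would make \<open>circle_norm (of_rat r * \<alpha>)\<close> smaller
  than \<open>\<delta>\<close>. The intersections are thus empty, not merely null.\<close>

lemma set_of_nonrecurrence_circle_rotation:
  assumes "\<delta> > 0" and R: "\<And>r. r \<in> R \<Longrightarrow> r \<noteq> 0 \<Longrightarrow> \<delta> \<le> circle_norm (of_rat r * \<alpha>)"
  shows "set_of_nonrecurrence R"
proof -
  define E where "E = circle.mball 0 (\<delta> / 2)"
  have E: "E \<in> sets circle_measure"
    unfolding E_def sets_circle_measure using circle.openin_mball by blast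
  have "measure circle_measure E > 0"
  proof -
    \<comment> \<open>An arc to the right of 0 suffices for positive measure; the cap 1/2 keeps it
      inside the carrier.\<close>
    define \<eta> where "\<eta> = min (1/2) (\<delta> / 2)"
    have \<eta>: "0 < \<eta>" "\<eta> < 1" using \<open>\<delta> > 0\<close> by (auto simp: \<eta>_def)
    have sub: "{0..<\<eta>} \<subseteq> {0..<1} \<inter> frac -` E"
    proof
      fix x assume "x \<in> {0..<\<eta>}"
      moreover from this have "circle_dist 0 x < \<eta>" using circle_dist_le_abs[of 0 x] by simp
      ultimately show "x \<in> {0..<1} \<inter> frac -` E"
        using \<eta> by (auto simp: E_def circle.in_mball frac_lt_1 \<eta>_def)
    qed
    have "emeasure lborel ({0..<1} \<inter> frac -` E) \<le> emeasure lborel {0..<1::real}"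
      using circle_measurable_vimage[OF E] by (intro emeasure_mono) auto
    then have "measure lborel {0..<\<eta>} \<le> measure lborel ({0..<1} \<inter> frac -` E)"
      using circle_measurable_vimage[OF E]
      by (intro measure_mono_fmeasurable[OF sub]) (auto simp: fmeasurable_def less_top intro: le_less_trans)
    then show ?thesis using \<eta> E by (simp add: measure_circle)
  qed
  moreover have "E \<inter> (circle_rotation \<alpha> r -` E \<inter> {0..<1}) = {}" if r: "r \<in> R" "r \<noteq> 0" for r
  proof (rule ccontr)
    assume "E \<inter> (circle_rotation \<alpha> r -` E \<inter> {0..<1}) \<noteq> {}"
    then obtain x where x: "x \<in> E" "circle_rotation \<alpha> r x \<in> E" by blast
    have "circle_norm (of_rat r * \<alpha>) = circle_dist (x + of_rat r * \<alpha>) x"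
      by (simp add: circle_dist_def)
    also have "\<dots> \<le> circle_dist (x + of_rat r * \<alpha>) 0 + circle_dist 0 x"
      by (rule circle_dist_triangle)
    also have "\<dots> < \<delta> / 2 + \<delta> / 2"
      using x by (intro add_strict_mono)
        (auto simp: E_def circle.in_mball circle_rotation_def circle_dist_commute[of _ 0])
    finally show False using R[OF r] by simp
  qed
  ultimately show ?thesis
    unfolding set_of_nonrecurrence_def set_of_recurrence_def
    using Q_system_circle_rotation[of \<alpha>] E by (metis less_irrefl measure_empty)
qed

text \<open>Pigeonhole: cut the circle into finitely many arcs of length at most
  \<open>\<delta>\<close>. Two values of \<open>b\<close> in one arc have a difference violating the
  gap.\<close>

lemma no_Delta_subset_circle_rotation:
  assumes "\<delta> > 0" and R: "\<And>r. r \<in> R \<Longrightarrow> r \<noteq> 0 \<Longrightarrow> \<delta> \<le> circle_norm (of_rat r * \<alpha>)"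
    and "Delta_set D" shows "\<not> D \<subseteq> R"
proof
  assume "D \<subseteq> R"
  obtain b :: "nat \<Rightarrow> rat" where b: "infinite (range b)" "D = {b j - b i | i j. i < j}"
    using \<open>Delta_set D\<close> by (auto simp: Delta_set_def)
  define f where "f q = \<lfloor>frac (of_rat q * \<alpha>) / \<delta>\<rfloor>" for q :: rat
  have "f ` range b \<subseteq> {0..\<lfloor>1 / \<delta>\<rfloor>}"
  proof -
    have "0 \<le> f q" "f q \<le> \<lfloor>1 / \<delta>\<rfloor>" for q
      using \<open>\<delta> > 0\<close> frac_lt_1[of "of_rat q * \<alpha>"]
      by (auto simp: f_def intro!: floor_mono divide_right_mono)
    then show ?thesis by auto
  qed
  then have "finite (f ` range b)" by (rule finite_subset) simp
  then obtain p where p: "infinite {q \<in> range b. f q = f p}"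
    using pigeonhole_infinite[OF b(1), of f] by blast
  then obtain q where q: "q \<in> range b" "f q = f p" 
    by (metis (mono_tags, lifting) empty_Collect_eq infinite_imp_nonempty)
  \<comment> \<open>Two distinct values are needed, not just two indices: \<open>b\<close> need not
    be injective, and the gap concerns nonzero differences only.\<close>
  then have "infinite ({q \<in> range b. f q = f p} - {q})" using p by simp
  then obtain q' where q': "q' \<in> range b" "f q' = f p" "q' \<noteq> q"
    by (metis (mono_tags, lifting) DiffE finite.emptyI ex_in_conv mem_Collect_eq singletonI)
  have close: "circle_norm (of_rat (u - v) * \<alpha>) < \<delta>" if "f u = f v" for u v
  proof -
    have "\<bar>frac (of_rat u * \<alpha>) / \<delta> - frac (of_rat v * \<alpha>) / \<delta>\<bar> < 1"
      using that unfolding f_def by linarith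
    then have "\<bar>frac (of_rat u * \<alpha>) - frac (of_rat v * \<alpha>)\<bar> < \<delta>"
      using \<open>\<delta> > 0\<close> by (simp add: diff_divide_distrib[symmetric] abs_divide)
    moreover have "circle_norm (of_rat (u - v) * \<alpha>)
        = circle_dist (frac (of_rat u * \<alpha>)) (frac (of_rat v * \<alpha>))"
      by (simp only: circle_dist_frac_left circle_dist_frac_right)
        (simp add: circle_dist_def of_rat_diff algebra_simps)
    ultimately show ?thesis
      using circle_norm_le_abs[of "frac (of_rat u * \<alpha>) - frac (of_rat v * \<alpha>)"]
      by (simp add: circle_dist_def)
  qed
  obtain i j where ij: "q = b i" "q' = b j" using q q' by blast
  then have "i \<noteq> j" using q' by auto
  then obtain k l where kl: "k < l" "b l \<noteq> b k" "f (b l) = f (b k)"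
    using ij q q' by (metis linorder_neqE_nat)
  then have "b l - b k \<in> R" using b \<open>D \<subseteq> R\<close> by blast
  then show False using R[of "b l - b k"] close[OF kl(3)] kl by auto
qed

section \<open>Sparseness of return times along a Folner sequence\<close>

text \<open>Each translate of \<open>R\<close> by a point of \<open>S\<close> meets
  \<open>\<Phi> N\<close> in almost as many points as \<open>R\<close> does, and the disjoint
  translates share the room in \<open>\<Phi> N\<close>. The factor 2 absorbs the boundary
  errors.\<close>

lemma Folner_card_disjoint_translates:
  assumes \<Phi>: "Folner_seq \<Phi>" and S: "finite S" "S \<noteq> {}"
    and disj: "disjoint_family_on (\<lambda>x. (\<lambda>a. a + x) ` R) S"
  shows "\<forall>\<^sub>F N in sequentially. real (card (R \<inter> \<Phi> N)) \<le> 2 / real (card S) * real (card (\<Phi> N))"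
proof -
  define e where "e x N = card (sym_diff ((\<lambda>a. a + x) ` \<Phi> N) (\<Phi> N))" for x N
  have fin: "finite (\<Phi> N)" "\<Phi> N \<noteq> {}" for N using \<Phi> by (auto simp: Folner_seq_def)
  then have pos: "real (card (\<Phi> N)) > 0" for N by (simp add: card_gt_0_iff)
  \<comment> \<open>As \<open>S\<close> is finite, the total relative error tends to 0, so
    eventually it is below 1.\<close>
  have "(\<lambda>N. \<Sum>x\<in>S. real (e x N) / real (card (\<Phi> N))) \<longlonglongrightarrow> (\<Sum>x\<in>S. 0)"
    using \<Phi> by (intro tendsto_sum) (simp add: e_def Folner_seq_def)
  then have "\<forall>\<^sub>F N in sequentially. (\<Sum>x\<in>S. real (e x N) / real (card (\<Phi> N))) < 1"
    by (rule order_tendstoD(2)) simp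
  then show ?thesis
  proof eventually_elim
    case (elim N)
    have translate: "card (R \<inter> \<Phi> N) \<le> card ((\<lambda>a. a + x) ` R \<inter> \<Phi> N) + e x N" for x
    proof -
      have "card (R \<inter> \<Phi> N) = card ((\<lambda>a. a + x) ` (R \<inter> \<Phi> N))"
        by (simp add: card_image)
      also have "\<dots> \<le> card (((\<lambda>a. a + x) ` R \<inter> \<Phi> N) \<union> sym_diff ((\<lambda>a. a + x) ` \<Phi> N) (\<Phi> N))"
        using fin by (intro card_mono) auto
      also have "\<dots> \<le> card ((\<lambda>a. a + x) ` R \<inter> \<Phi> N) + e x N"
        unfolding e_def by (rule card_Un_le)
      finally show ?thesis .
    qed
    have "card S * card (R \<inter> \<Phi> N) \<le> (\<Sum>x\<in>S. card ((\<lambda>a. a + x) ` R \<inter> \<Phi> N) + e x N)"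
      using sum_mono[of S "\<lambda>_. card (R \<inter> \<Phi> N)"] translate by simp
    also have "\<dots> = card (\<Union>x\<in>S. (\<lambda>a. a + x) ` R \<inter> \<Phi> N) + (\<Sum>x\<in>S. e x N)"
      using disj S fin by (subst card_UN_disjoint) (auto simp: sum.distrib disjoint_family_on_def)
    also have "\<dots> \<le> card (\<Phi> N) + (\<Sum>x\<in>S. e x N)"
      using fin by (intro add_right_mono card_mono) auto
    finally have "real (card S * card (R \<inter> \<Phi> N)) \<le> real (card (\<Phi> N) + (\<Sum>x\<in>S. e x N))"
      by (rule of_nat_mono)
    moreover have "(\<Sum>x\<in>S. real (e x N)) < real (card (\<Phi> N))"
      using elim pos[of N] by (simp add: sum_divide_distrib[symmetric])
    ultimately have "real (card S) * real (card (R \<inter> \<Phi> N)) \<le> 2 * real (card (\<Phi> N))"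
      by simp
    moreover have "real (card S) > 0" using S by (simp add: card_gt_0_iff)
    ultimately show ?case by (simp add: field_simps)
  qed
qed

text \<open>An integral \<open>of_rat q * \<alpha>\<close> could be divided by \<open>q\<close>,
  making \<open>\<alpha>\<close> rational. All later appeals to irrationality go through this
  fact.\<close>

lemma circle_norm_irrational_pos:
  assumes "\<alpha> \<notin> \<rat>" "q \<noteq> 0"
  shows "0 < circle_norm (of_rat q * \<alpha>)"
proof -
  have "of_rat q * \<alpha> \<notin> \<int>"
  proof
    assume "of_rat q * \<alpha> \<in> \<int>"
    then have "(of_rat q * \<alpha>) / of_rat q \<in> \<rat>" by (intro Rats_divide) (auto simp: Ints_subset_Rats[THEN subsetD])
    then show False using assms by simp
  qed
  then show ?thesis using circle_norm_eq_0_iff[of "of_rat q * \<alpha>"] circle_norm_nonneg[of "of_rat q * \<alpha>"]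
    by linarith
qed

lemma circle_norm_finite_lower_bound:
  assumes "\<alpha> \<notin> \<rat>" "finite F"
  shows "\<exists>\<delta>>0. \<forall>q\<in>F. q \<noteq> 0 \<longrightarrow> \<delta> \<le> circle_norm (of_rat q * \<alpha>)"
proof -
  \<comment> \<open>The 1 keeps the set nonempty when \<open>F\<close> has no nonzero
    element.\<close>
  let ?M = "insert 1 ((\<lambda>q. circle_norm (of_rat q * \<alpha>)) ` (F - {0}))"
  have "0 < Min ?M"
    using assms by (auto simp: Min_gr_iff circle_norm_irrational_pos)
  moreover have "\<forall>q\<in>F. q \<noteq> 0 \<longrightarrow> Min ?M \<le> circle_norm (of_rat q * \<alpha>)"
    using assms by (intro ballI impI Min_le) auto
  ultimately show ?thesis by blast
qed

text \<open>If \<open>\<delta>\<close> separates the multiples of \<open>\<alpha>\<close> by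
  \<open>K\<close> rationals modulo 1, the return times within \<open>\<delta> / 2\<close> have
  disjoint translates by these rationals; \<open>K\<close> is chosen with
  \<open>2 / K < c\<close>.\<close>

lemma Folner_return_times_sparse:
  assumes \<Phi>: "Folner_seq \<Phi>" and \<alpha>: "\<alpha> \<notin> \<rat>" and "c > 0"
  shows "\<exists>\<delta>>0. \<forall>\<^sub>F N in sequentially.
    real (card ({q. circle_norm (of_rat (q - t) * \<alpha>) < \<delta>} \<inter> \<Phi> N)) \<le> c * real (card (\<Phi> N))"
proof -
  obtain K :: nat where K: "2 / c < real K" using reals_Archimedean2 by blast
  have "2 / c > 0" using \<open>c > 0\<close> by simp
  then have K0: "real K > 0" using K by linarith
  \<comment> \<open>Any \<open>K\<close> distinct rationals would serve.\<close>
  define S where "S = (of_nat :: nat \<Rightarrow> rat) ` {..<K}"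
  have S: "finite S" "S \<noteq> {}" "card S = K"
    using K0 by (auto simp: S_def card_image inj_on_def)
  obtain \<delta> where \<delta>: "\<delta> > 0"
    "\<And>x y. x \<in> S \<Longrightarrow> y \<in> S \<Longrightarrow> x \<noteq> y \<Longrightarrow> \<delta> \<le> circle_norm (of_rat (x - y) * \<alpha>)"
    using circle_norm_finite_lower_bound[OF \<alpha>, of "(\<lambda>(x, y). x - y) ` (S \<times> S)"] S by fastforce
  define R where "R = {q. circle_norm (of_rat (q - t) * \<alpha>) < \<delta> / 2}"
  have "disjoint_family_on (\<lambda>x. (\<lambda>a. a + x) ` R) S"
    unfolding disjoint_family_on_def
  proof (intro ballI impI, rule ccontr)
    fix x y assume xy: "x \<in> S" "y \<in> S" "x \<noteq> y" and "(\<lambda>a. a + x) ` R \<inter> (\<lambda>a. a + y) ` R \<noteq> {}"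
    then obtain p q where pq: "p \<in> R" "q \<in> R" "p + x = q + y" by auto
    then have "x - y = (q - t) - (p - t)" by (simp add: algebra_simps)
    then have eq: "of_rat (x - y) * \<alpha> = of_rat (q - t) * \<alpha> + - (of_rat (p - t) * \<alpha>)"
      by (simp only: of_rat_diff) (simp add: algebra_simps)
    have "circle_norm (of_rat (x - y) * \<alpha>)
        \<le> circle_norm (of_rat (q - t) * \<alpha>) + circle_norm (of_rat (p - t) * \<alpha>)"
      unfolding eq using circle_norm_triangle by (metis circle_norm_minus)
    also have "\<dots> < \<delta> / 2 + \<delta> / 2" using pq by (intro add_strict_mono) (auto simp: R_def)
    finally show False using \<delta>(2)[OF xy] by simp
  qed
  from Folner_card_disjoint_translates[OF \<Phi> S(1,2) this]
  have "\<forall>\<^sub>F N in sequentially. real (card (R \<inter> \<Phi> N)) \<le> c * real (card (\<Phi> N))"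
  proof eventually_elim
    case (elim N)
    have "2 / real (card S) \<le> c" using K K0 \<open>c > 0\<close> S by (simp add: field_simps)
    then show ?case using elim by (meson mult_right_mono of_nat_0_le_iff order_trans)
  qed
  then show ?thesis using \<delta>(1) unfolding R_def by (intro exI[of _ "\<delta> / 2"]) simp
qed

lemma exists_irrational: "\<exists>\<alpha>::real. \<alpha> \<notin> \<rat>"
  using countable_rat uncountable_UNIV_real by (metis UNIV_eq_I)

section \<open>Construction of the dense set\<close>

lemma exists_dense_set_avoiding_return_times:
  assumes \<Phi>: "Folner_seq \<Phi>" and \<alpha>: "\<alpha> \<notin> \<rat>" and "\<epsilon> > 0"
  shows "\<exists>A. lower_density \<Phi> A > ereal (1 - \<epsilon>) \<and>
    (\<forall>t. \<exists>\<delta>>0. \<forall>r\<in>rat_shift A t. r \<noteq> 0 \<longrightarrow> \<delta> \<le> circle_norm (of_rat r * \<alpha>))"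
proof -
  \<comment> \<open>The \<open>c n\<close> sum to \<open>\<epsilon> / 2\<close>; the other half of
    \<open>\<epsilon>\<close> pays for the strict inequality, since the liminf preserves only weak
    bounds.\<close>
  define c where "c n = \<epsilon> / 2 * (1/2) ^ Suc n" for n :: nat
  define t :: "nat \<Rightarrow> rat" where "t = from_nat"
  define R where "R n \<delta> = {q. circle_norm (of_rat (q - t n) * \<alpha>) < \<delta>}" for n \<delta>
  have fin: "finite (\<Phi> N)" "\<Phi> N \<noteq> {}" for N using \<Phi> by (auto simp: Folner_seq_def)
  then have pos: "real (card (\<Phi> N)) > 0" for N by (simp add: card_gt_0_iff)
  have "\<exists>\<delta> M. \<delta> > 0 \<and> (\<forall>N\<ge>M. real (card (R n \<delta> \<inter> \<Phi> N)) \<le> c n * real (card (\<Phi> N)))" for n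
    using Folner_return_times_sparse[OF \<Phi> \<alpha>, of "c n" "t n"] \<open>\<epsilon> > 0\<close>
    unfolding R_def c_def eventually_sequentially by fastforce
  then obtain \<delta> M where \<delta>: "\<And>n. \<delta> n > 0"
    and M: "\<And>n N. N \<ge> M n \<Longrightarrow> real (card (R n (\<delta> n) \<inter> \<Phi> N)) \<le> c n * real (card (\<Phi> N))"
    by metis
  \<comment> \<open>\<open>F n\<close> contains \<open>\<Phi> N\<close> whenever
    \<open>N \<le> n\<close> or \<open>N < M n\<close>. So stage \<open>n\<close> removes points of
    \<open>\<Phi> N\<close> only if \<open>n < N\<close> and \<open>M n \<le> N\<close>: finitely
    many stages, each obeying its density bound.\<close>
  define F where "F n = (\<Union>N<max (Suc n) (M n). \<Phi> N)" for n
  define A where "A = - (\<Union>n. R n (\<delta> n) - F n)"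
  have "\<exists>d>0. \<forall>r\<in>rat_shift A s. r \<noteq> 0 \<longrightarrow> d \<le> circle_norm (of_rat r * \<alpha>)" for s
  proof -
    obtain n where n: "s = t n" unfolding t_def by (metis from_nat_to_nat)
    have "finite ((\<lambda>f. f - s) ` F n)" unfolding F_def using fin by auto
    from circle_norm_finite_lower_bound[OF \<alpha> this] obtain d
      where d: "d > 0" "\<And>f. f \<in> F n \<Longrightarrow> f \<noteq> s \<Longrightarrow> d \<le> circle_norm (of_rat (f - s) * \<alpha>)"
      by force
    have "min d (\<delta> n) \<le> circle_norm (of_rat r * \<alpha>)" if r: "r \<in> rat_shift A s" "r \<noteq> 0" for r
    proof -
      obtain a where a: "a \<in> A" "r = a - s" using r by (auto simp: rat_shift_def)
      \<comment> \<open>Outside \<open>R n (\<delta> n)\<close> the gap is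
        \<open>\<delta> n\<close>; on the finite exceptional set it is \<open>d\<close>.\<close>
      then have "a \<notin> R n (\<delta> n) \<or> a \<in> F n" by (auto simp: A_def)
      then show ?thesis using d(2)[of a] a r n by (auto simp: R_def min_le_iff_disj)
    qed
    then show ?thesis using d(1) \<delta>[of n] by (intro exI[of _ "min d (\<delta> n)"]) auto
  qed
  note avoids = this
  \<comment> \<open>Thanks to the exceptional sets, the bound holds for every \<open>N\<close>, not
    just eventually.\<close>
  have "1 - \<epsilon> / 2 \<le> real (card (A \<inter> \<Phi> N)) / real (card (\<Phi> N))" for N
  proof -
    have "\<Phi> N - A \<subseteq> (\<Union>n\<in>{n. n < N \<and> M n \<le> N}. R n (\<delta> n) \<inter> \<Phi> N)"
    proof
      fix q assume q: "q \<in> \<Phi> N - A"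
      then obtain n where n: "q \<in> R n (\<delta> n)" "q \<notin> F n" by (auto simp: A_def)
      then have "\<not> N < max (Suc n) (M n)" using q unfolding F_def by blast
      then have "n < N" "M n \<le> N" by auto
      then show "q \<in> (\<Union>n\<in>{n. n < N \<and> M n \<le> N}. R n (\<delta> n) \<inter> \<Phi> N)" using q n by auto
    qed
    then have "card (\<Phi> N - A) \<le> card (\<Union>n\<in>{n. n < N \<and> M n \<le> N}. R n (\<delta> n) \<inter> \<Phi> N)"
      using fin by (intro card_mono) auto
    also have "\<dots> \<le> (\<Sum>n\<in>{n. n < N \<and> M n \<le> N}. card (R n (\<delta> n) \<inter> \<Phi> N))"
      by (rule card_UN_le) simp
    finally have "real (card (\<Phi> N - A)) \<le> (\<Sum>n\<in>{n. n < N \<and> M n \<le> N}. real (card (R n (\<delta> n) \<inter> \<Phi> N)))"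
      by (metis of_nat_mono of_nat_sum)
    also have "\<dots> \<le> (\<Sum>n\<in>{n. n < N \<and> M n \<le> N}. c n * real (card (\<Phi> N)))"
      using M by (intro sum_mono) auto
    also have "\<dots> \<le> (\<Sum>n<N. c n * real (card (\<Phi> N)))"
      using \<open>\<epsilon> > 0\<close> by (intro sum_mono2) (auto simp: c_def)
    also have "\<dots> = (\<Sum>n<N. c n) * real (card (\<Phi> N))"
      by (simp add: sum_distrib_right)
    also have "(\<Sum>n<N. c n) = \<epsilon> / 2 * (1 - (1/2) ^ N)"
      by (induction N) (auto simp: c_def field_simps)
    also have "\<dots> * real (card (\<Phi> N)) \<le> \<epsilon> / 2 * real (card (\<Phi> N))"
      using \<open>\<epsilon> > 0\<close> by (intro mult_right_mono) auto
    finally have "real (card (\<Phi> N - A)) \<le> \<epsilon> / 2 * real (card (\<Phi> N))" .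
    moreover have "card (\<Phi> N) = card (A \<inter> \<Phi> N) + card (\<Phi> N - A)"
      using card_Int_Diff[OF fin(1), of N A] by (simp add: Int_commute)
    ultimately show ?thesis using pos[of N] by (simp add: field_simps)
  qed
  then have "ereal (1 - \<epsilon> / 2) \<le> lower_density \<Phi> A"
    unfolding lower_density_def by (intro Liminf_bounded always_eventually) simp
  moreover have "ereal (1 - \<epsilon>) < ereal (1 - \<epsilon> / 2)"
    using \<open>\<epsilon> > 0\<close> by simp
  ultimately have "ereal (1 - \<epsilon>) < lower_density \<Phi> A"
    by (rule less_le_trans[rotated])
  then show ?thesis using avoids by (intro exI[of _ A]) simp
qed

text \<open>For each \<open>t\<close> one gap, which may depend on \<open>t\<close>, yields both
  conclusions; the one on \<Delta>-sets is drawn from the gap directly, not from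
  nonrecurrence.\<close>

theorem theorem10p2:
  fixes \<Phi> :: "nat \<Rightarrow> rat set" and \<epsilon> :: real
  assumes "Folner_seq \<Phi>" and "\<epsilon> > 0"
  shows "\<exists>A :: rat set.
           lower_density \<Phi> A > ereal (1 - \<epsilon>) \<and>
           (\<forall>t. set_of_nonrecurrence (rat_shift A t)) \<and>
           (\<forall>t. \<not> (\<exists>D. Delta_set D \<and> D \<subseteq> rat_shift A t))"
proof -
  obtain \<alpha> :: real where "\<alpha> \<notin> \<rat>" using exists_irrational by blast
  from exists_dense_set_avoiding_return_times[OF assms(1) this assms(2)]
  obtain A where dense: "lower_density \<Phi> A > ereal (1 - \<epsilon>)"
    and gap: "\<And>t. \<exists>\<delta>>0. \<forall>r\<in>rat_shift A t. r \<noteq> 0 \<longrightarrow> \<delta> \<le> circle_norm (of_rat r * \<alpha>)"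
    by blast
  have "set_of_nonrecurrence (rat_shift A t)"
    and "\<not> (\<exists>D. Delta_set D \<and> D \<subseteq> rat_shift A t)" for t
  proof -
    obtain \<delta> where \<delta>: "\<delta> > 0"
      "\<And>r. r \<in> rat_shift A t \<Longrightarrow> r \<noteq> 0 \<Longrightarrow> \<delta> \<le> circle_norm (of_rat r * \<alpha>)"
      using gap[of t] by blast
    show "set_of_nonrecurrence (rat_shift A t)"
      by (rule set_of_nonrecurrence_circle_rotation[OF \<delta>])
    show "\<not> (\<exists>D. Delta_set D \<and> D \<subseteq> rat_shift A t)"
      using no_Delta_subset_circle_rotation[OF \<delta>] by blast
  qed
  with dense show ?thesis by (intro exI[of _ A]) simp
qed

end
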